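(* Let $H$ be a bipartite graph and $\alpha$ a $2$-edge-colouring such that $(H,\alpha)$ is complex-norming. Then for every $f\in\mathcal{F}_{\mathbb{C}}$, $t_{H,\alpha}(f)$ is a positive real number unless $f=0$ almost everywhere.
   Context: $\mathcal{F}_{\mathbb{C}}$ is the complex vector space of bounded measurable $f:[0,1]^2\to\mathbb{C}$. $H$ is finite, nonempty, without isolated vertices, with fixed bipartition $A\cup B$ and edges $(u,v)$, $u\in A$, $v\in B$. For $\alpha:E(H)\to\{0,1\}$, with variables $x_u$ ($u\in A$), $y_v$ ($v\in B$) in $[0,1]$ and Lebesgue measure, $t_{H,\alpha}(f)=\int\prod_{e=(u,v)\in E(H)}f(x_u,y_v)^{\alpha(e)}\overline{f(x_u,y_v)}^{1-\alpha(e)}$. $(H,\alpha)$ is complex-norming if $|t_{H,\alpha}(\cdot)|^{1/|E(H)|}$ is a seminorm on $\mathcal{F}_{\mathbb{C}}$ vanishing only on functions that are $0$ a.e. *)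

theory Defs
  imports "HOL-Probability.Probability"
begin

text \<open>
  Functions on the unit square are total functions on \<^typ>\<open>real \<times> real\<close>; their values outside
  the square are unconstrained and never used.
\<close>

abbreviation unit_square :: "(real \<times> real) set" where
  "unit_square \<equiv> {0..1} \<times> {0..1}"

definition bounded_measurable_on_square :: "(real \<times> real \<Rightarrow> complex) set" where
  "bounded_measurable_on_square =
     {f. f \<in> borel_measurable (lebesgue_on unit_square) \<and> bounded (f ` unit_square)}"

definition zero_ae :: "(real \<times> real \<Rightarrow> complex) \<Rightarrow> bool" where
  "zero_ae f \<longleftrightarrow> (AE p in lebesgue_on unit_square. f p = 0)"

definition seminorm_on :: "('p \<Rightarrow> complex) set \<Rightarrow> (('p \<Rightarrow> complex) \<Rightarrow> real) \<Rightarrow> bool" where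
  "seminorm_on V N \<longleftrightarrow>
     (\<forall>f\<in>V. 0 \<le> N f) \<and>
     (\<forall>f\<in>V. \<forall>c. N (\<lambda>p. c * f p) = cmod c * N f) \<and>
     (\<forall>f\<in>V. \<forall>g\<in>V. N (\<lambda>p. f p + g p) \<le> N f + N g)"

text \<open>
  The edges of a simple bipartite graph are represented as pairs oriented from \<open>A\<close> to \<open>B\<close>.
\<close>

locale finite_bipartite_graph =
  fixes A B :: "'v set" and E :: "('v \<times> 'v) set"
  assumes finite_A: "finite A"
    and finite_B: "finite B"
    and disjoint_parts: "A \<inter> B = {}"
    and edges: "E \<subseteq> A \<times> B"
    and vertices_nonempty: "A \<union> B \<noteq> {}"
    and no_isolated_A: "u \<in> A \<Longrightarrow> \<exists>v. (u, v) \<in> E"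
    and no_isolated_B: "v \<in> B \<Longrightarrow> \<exists>u. (u, v) \<in> E"

text \<open>
  Lebesgue measure on the cube of all vertex assignments. The completion makes
  \<open>z \<mapsto> f (z u, z v)\<close> measurable for every Lebesgue (not only Borel) measurable \<open>f\<close>
  and \<open>u \<noteq> v\<close>; a product measure in the library is not complete.
\<close>

definition vertex_cube :: "'v set \<Rightarrow> ('v \<Rightarrow> real) measure" where
  "vertex_cube V = completion (Pi\<^sub>M V (\<lambda>_. restrict_space lborel {0..1}))"

text \<open>
  One assignment \<open>z\<close> carries both families of variables: \<open>x\<^sub>u = z u\<close> for \<open>u \<in> A\<close> and
  \<open>y\<^sub>v = z v\<close> for \<open>v \<in> B\<close>. A colouring takes the values 0 and 1 on edges, so the truncated
  subtraction is harmless.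
\<close>

definition hom_density ::
  "'v set \<Rightarrow> 'v set \<Rightarrow> ('v \<times> 'v) set \<Rightarrow> ('v \<times> 'v \<Rightarrow> nat) \<Rightarrow> (real \<times> real \<Rightarrow> complex) \<Rightarrow> complex"
  where
  "hom_density A B E \<alpha> f =
     (LINT z|vertex_cube (A \<union> B).
        (\<Prod>(u, v)\<in>E. f (z u, z v) ^ \<alpha> (u, v) * cnj (f (z u, z v)) ^ (1 - \<alpha> (u, v))))"

definition complex_norming ::
  "'v set \<Rightarrow> 'v set \<Rightarrow> ('v \<times> 'v) set \<Rightarrow> ('v \<times> 'v \<Rightarrow> nat) \<Rightarrow> bool" where
  "complex_norming A B E \<alpha> \<longleftrightarrow>
     (let N = (\<lambda>f. cmod (hom_density A B E \<alpha> f) powr (1 / real (card E)))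
      in seminorm_on bounded_measurable_on_square N \<and>
         (\<forall>f\<in>bounded_measurable_on_square. N f = 0 \<longrightarrow> zero_ae f))"

end

theory Submission imports Defs begin

text \<open>
  Only the non-vanishing of \<open>t\<^sub>H\<^sub>,\<^sub>\<alpha>\<close> off the null functions matters. Through step functions it
  passes to kernels on finite index sets. If \<open>H\<close> is connected, the values at nonzero finite
  kernels are closed under multiplication (tensor products), addition (direct sums) and positive
  scaling; since they avoid 0, they are all positive. Otherwise the density factorises over a
  disconnection, and each factor is again non-vanishing. Finally, the density of an arbitrary \<open>f\<close>
  is the limit of the expected densities of the kernels \<open>f (z\<^sub>i, z\<^sub>j)\<close> sampled at independent
  uniform points, so it is nonnegative, and by assumption it is not 0.
\<close>

text \<open>The hypothesis of nonvanishing holds for kernels of every size, which leaves room to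
  realise sums and products of values at larger kernels. Connectedness serves addition: a map of V
  into a disjoint union of two index sets may send different components of the graph to different
  blocks, and such mixed maps would contribute cross terms; on a connected graph each of them meets
  an edge where the kernel is 0. Across a disconnection both factors see the same kernel, so a
  nonzero product makes each of them nonzero before any sign is known. Sampling takes the place of
  approximating f by step functions: each sample is a finite kernel, injective assignments have
  exactly the desired expectation, and the others form an O(1/N) share of all assignments.\<close>

section \<open>Complex cones closed under multiplication\<close>

text \<open>S is a convex cone that contains 1 and avoids 0, which keeps it out of the closed left
  half-plane. Squaring doubles arguments, so repeated squares of a nonreal element would enter that
  half-plane.\<close>

lemma cone_semiring_positive:
  fixes S :: "complex set"
  assumes zero: "0 \<notin> S" and one: "1 \<in> S"
    and add: "\<And>x y. x \<in> S \<Longrightarrow> y \<in> S \<Longrightarrow> x + y \<in> S"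
    and mult: "\<And>x y. x \<in> S \<Longrightarrow> y \<in> S \<Longrightarrow> x * y \<in> S"
    and scale: "\<And>r x. 0 < r \<Longrightarrow> x \<in> S \<Longrightarrow> complex_of_real r * x \<in> S"
  shows "S \<subseteq> complex_of_real ` {0<..}"
proof
  \<comment> \<open>If \<open>Re w \<le> 0\<close>, then \<open>w\<^sup>2 - 2 Re w w + \<bar>w\<bar>\<^sup>2 = 0\<close> has nonnegative coefficients.\<close>
  have Re_pos: "0 < Re w" if w: "w \<in> S" for w
  proof (rule ccontr)
    assume "\<not> 0 < Re w"
    have "w \<noteq> 0" using w zero by auto
    then have sq: "of_real ((cmod w)\<^sup>2) * 1 \<in> S" using scale[OF _ one, of "(cmod w)\<^sup>2"] by simp
    have "w * w + of_real ((cmod w)\<^sup>2) * 1 \<in> S" using add mult sq w by blast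
    moreover have lin: "of_real (- 2 * Re w) * w \<in> S" if "Re w < 0"
      using scale[OF _ w, of "- 2 * Re w"] that by simp
    \<comment> \<open>For \<open>Re w = 0\<close> the linear term is absent, because
      \<open>scale\<close> needs a positive factor; the first two summands then already add up to
      0.\<close>
    ultimately have "w * w + of_real ((cmod w)\<^sup>2) * 1 + of_real (- 2 * Re w) * w \<in> S"
      using add[OF _ lin] \<open>\<not> 0 < Re w\<close> by (cases "Re w = 0") auto
    also have "w * w + of_real ((cmod w)\<^sup>2) * 1 + of_real (- 2 * Re w) * w = 0"
      unfolding cmod_power2 by (simp add: complex_eq_iff power2_eq_square algebra_simps)
    finally show False using zero by simp
  qed
  have Im_less: "\<bar>Im w\<bar> < Re w" if w: "w \<in> S" for w
  proof -
    have "0 < Re (w * w)" using Re_pos mult w by blast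
    then have "(Im w)\<^sup>2 < (Re w)\<^sup>2" by (simp add: power2_eq_square)
    then show ?thesis using Re_pos[OF w] power2_less_imp_less[of "\<bar>Im w\<bar>" "Re w"] by simp
  qed
  fix w assume w: "w \<in> S"
  have "Im w = 0"
  proof (rule ccontr)
    assume Im: "Im w \<noteq> 0"
    define c where "c = \<bar>Im w\<bar> / Re w"
    have c: "0 < c" using Im Re_pos[OF w] by (simp add: c_def)
    \<comment> \<open>Squaring at least doubles the slope of an element, while all slopes are below 1.\<close>
    have "\<exists>z\<in>S. 2 ^ k * c * Re z \<le> \<bar>Im z\<bar>" for k :: nat
    proof (induction k)
      case 0
      show ?case using w Re_pos[OF w] by (auto simp: c_def intro!: bexI[of _ w])
    next
      case (Suc k)
      then obtain z where z: "z \<in> S" "2 ^ k * c * Re z \<le> \<bar>Im z\<bar>" by blast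
      have "2 ^ Suc k * c * Re (z * z) \<le> 2 ^ Suc k * c * (Re z * Re z)"
        using c by (intro mult_left_mono) auto
      also have "\<dots> = 2 * Re z * (2 ^ k * c * Re z)" by simp
      also have "\<dots> \<le> 2 * Re z * \<bar>Im z\<bar>"
        using z Re_pos[OF z(1)] by (intro mult_left_mono) auto
      also have "\<dots> = \<bar>Im (z * z)\<bar>"
        using Re_pos[OF z(1)] by (simp add: abs_mult flip: mult_2)
      finally show ?case using mult[OF z(1) z(1)] by blast
    qed
    moreover obtain k where "1 / c < 2 ^ k" using real_arch_pow[of 2 "1 / c"] by auto
    ultimately obtain z where z: "z \<in> S" "2 ^ k * c * Re z \<le> \<bar>Im z\<bar>" by blast
    have "1 < 2 ^ k * c" using \<open>1 / c < 2 ^ k\<close> c by (simp add: field_simps)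
    then have "Re z < 2 ^ k * c * Re z" using Re_pos[OF z(1)] by simp
    then show False using z Im_less[OF z(1)] by simp
  qed
  then show "w \<in> complex_of_real ` {0<..}"
    using Re_pos[OF w] by (intro image_eqI[of _ _ "Re w"]) (auto simp: complex_eq_iff)
qed

section \<open>Homomorphism sums over finite index sets\<close>

definition coloured_factor :: "nat \<Rightarrow> complex \<Rightarrow> complex" where
  "coloured_factor c x = x ^ c * cnj x ^ (1 - c)"

lemma coloured_factor_mult: "coloured_factor c (x * y) = coloured_factor c x * coloured_factor c y"
  by (simp add: coloured_factor_def power_mult_distrib)

lemma coloured_factor_one [simp]: "coloured_factor c 1 = 1"
  by (simp add: coloured_factor_def)

lemma coloured_factor_zero: "c \<in> {0, 1} \<Longrightarrow> coloured_factor c 0 = 0"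
  by (auto simp: coloured_factor_def)

lemma coloured_factor_of_real: "c \<in> {0, 1} \<Longrightarrow> coloured_factor c (of_real r) = of_real r"
  by (auto simp: coloured_factor_def)

lemma norm_coloured_factor: "c \<in> {0, 1} \<Longrightarrow> norm (coloured_factor c x) = norm x"
  by (auto simp: coloured_factor_def)

text \<open>The index type is left open so that one product serves both as the integrand of
  \<open>hom_density\<close> (real points) and as the summand of a homomorphism sum (finite
  indices).\<close>

definition edge_product ::
  "('v \<times> 'v) set \<Rightarrow> ('v \<times> 'v \<Rightarrow> nat) \<Rightarrow> ('i \<times> 'i \<Rightarrow> complex) \<Rightarrow> ('v \<Rightarrow> 'i) \<Rightarrow> complex" where
  "edge_product E \<alpha> g z = (\<Prod>(u, v)\<in>E. coloured_factor (\<alpha> (u, v)) (g (z u, z v)))"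

text \<open>Up to normalisation this is the density of a step function whose two axes carry the same
  partition, with cells indexed by \<open>I\<close>.\<close>

definition hom_sum ::
  "'i set \<Rightarrow> 'v set \<Rightarrow> ('v \<times> 'v) set \<Rightarrow> ('v \<times> 'v \<Rightarrow> nat) \<Rightarrow> ('i \<times> 'i \<Rightarrow> complex) \<Rightarrow> complex" where
  "hom_sum I V E \<alpha> G =
     (\<Sum>\<phi>\<in>V \<rightarrow>\<^sub>E I. edge_product E \<alpha> G \<phi>)"

lemma hom_sum_cong:
  assumes "E \<subseteq> V \<times> V" "\<And>i j. i \<in> I \<Longrightarrow> j \<in> I \<Longrightarrow> G (i, j) = H (i, j)"
  shows "hom_sum I V E \<alpha> G = hom_sum I V E \<alpha> H"
  unfolding hom_sum_def edge_product_def using assms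
  by (intro sum.cong prod.cong refl) (auto simp: PiE_iff subset_iff)

text \<open>Brings direct sums and tensor products, which live on shifted intervals and on sets of
  pairs, back to initial segments of the naturals.\<close>

lemma hom_sum_reindex:
  assumes h: "bij_betw h I J" and E: "E \<subseteq> V \<times> V"
  shows "hom_sum I V E \<alpha> (\<lambda>(i, j). G (h i, h j)) = hom_sum J V E \<alpha> G"
  unfolding hom_sum_def edge_product_def
proof (rule sum.reindex_bij_witness
    [of _ "\<lambda>\<psi>. restrict (inv_into I h \<circ> \<psi>) V" "\<lambda>\<phi>. restrict (h \<circ> \<phi>) V"])
  have img: "h ` I = J" and inj: "inj_on h I" using h by (auto simp: bij_betw_def)
  fix \<phi> assume \<phi>: "\<phi> \<in> V \<rightarrow>\<^sub>E I"
  show "restrict (inv_into I h \<circ> restrict (h \<circ> \<phi>) V) V = \<phi>"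
    using \<phi> inj by (auto simp: fun_eq_iff PiE_iff extensional_def)
  show "restrict (h \<circ> \<phi>) V \<in> V \<rightarrow>\<^sub>E J" using \<phi> img by (auto simp: PiE_iff)
  show "(\<Prod>(u, v)\<in>E. coloured_factor (\<alpha> (u, v)) (G (restrict (h \<circ> \<phi>) V u, restrict (h \<circ> \<phi>) V v))) =
    (\<Prod>(u, v)\<in>E. coloured_factor (\<alpha> (u, v)) (case (\<phi> u, \<phi> v) of (i, j) \<Rightarrow> G (h i, h j)))"
    using E by (intro prod.cong) auto
next
  have img: "h ` I = J" using h by (auto simp: bij_betw_def)
  fix \<psi> assume \<psi>: "\<psi> \<in> V \<rightarrow>\<^sub>E J"
  show "restrict (h \<circ> restrict (inv_into I h \<circ> \<psi>) V) V = \<psi>"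
    using \<psi> img by (auto simp: fun_eq_iff PiE_iff extensional_def f_inv_into_f)
  show "restrict (inv_into I h \<circ> \<psi>) V \<in> V \<rightarrow>\<^sub>E I"
    using \<psi> img by (auto simp: PiE_iff inv_into_into)
qed

text \<open>An assignment into \<open>I \<times> J\<close> is a pair of assignments, and
  \<open>coloured_factor\<close> is multiplicative, so the double sum separates.\<close>

lemma hom_sum_tensor:
  assumes E: "E \<subseteq> V \<times> V"
  shows "hom_sum (I \<times> J) V E \<alpha> (\<lambda>((i, j), (k, l)). G (i, k) * H (j, l)) =
    hom_sum I V E \<alpha> G * hom_sum J V E \<alpha> H"
  unfolding hom_sum_def edge_product_def sum_product sum.cartesian_product
proof (rule sum.reindex_bij_witness
    [of _ "\<lambda>(\<phi>, \<psi>). \<lambda>v\<in>V. (\<phi> v, \<psi> v)" "\<lambda>\<rho>. (restrict (fst \<circ> \<rho>) V, restrict (snd \<circ> \<rho>) V)"])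
  fix \<rho> assume \<rho>: "\<rho> \<in> V \<rightarrow>\<^sub>E I \<times> J"
  show "(case (restrict (fst \<circ> \<rho>) V, restrict (snd \<circ> \<rho>) V) of (\<phi>, \<psi>) \<Rightarrow> \<lambda>v\<in>V. (\<phi> v, \<psi> v)) = \<rho>"
    using \<rho> by (auto simp: fun_eq_iff PiE_iff extensional_def)
  show "(restrict (fst \<circ> \<rho>) V, restrict (snd \<circ> \<rho>) V) \<in> (V \<rightarrow>\<^sub>E I) \<times> (V \<rightarrow>\<^sub>E J)"
    using \<rho> by (fastforce simp: PiE_iff)
  show "(case (restrict (fst \<circ> \<rho>) V, restrict (snd \<circ> \<rho>) V) of (\<phi>, \<psi>) \<Rightarrow>
      (\<Prod>(u, v)\<in>E. coloured_factor (\<alpha> (u, v)) (G (\<phi> u, \<phi> v))) *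
      (\<Prod>(u, v)\<in>E. coloured_factor (\<alpha> (u, v)) (H (\<psi> u, \<psi> v)))) =
    (\<Prod>(u, v)\<in>E. coloured_factor (\<alpha> (u, v))
      ((\<lambda>((i, j), (k, l)). G (i, k) * H (j, l)) (\<rho> u, \<rho> v)))"
    using E by (auto simp: case_prod_unfold coloured_factor_mult subset_iff simp flip: prod.distrib
        intro!: prod.cong)
next
  fix p assume "p \<in> (V \<rightarrow>\<^sub>E I) \<times> (V \<rightarrow>\<^sub>E J)"
  then obtain \<phi> \<psi> where p: "p = (\<phi>, \<psi>)" "\<phi> \<in> V \<rightarrow>\<^sub>E I" "\<psi> \<in> V \<rightarrow>\<^sub>E J" by blast
  show "(restrict (fst \<circ> (case p of (\<phi>, \<psi>) \<Rightarrow> \<lambda>v\<in>V. (\<phi> v, \<psi> v))) V,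
      restrict (snd \<circ> (case p of (\<phi>, \<psi>) \<Rightarrow> \<lambda>v\<in>V. (\<phi> v, \<psi> v))) V) = p"
    using p by (auto simp: fun_eq_iff PiE_iff extensional_def)
  show "(case p of (\<phi>, \<psi>) \<Rightarrow> \<lambda>v\<in>V. (\<phi> v, \<psi> v)) \<in> V \<rightarrow>\<^sub>E I \<times> J"
    using p by (auto simp: PiE_iff)
qed

text \<open>Conjugation fixes real scalars, so every edge contributes r whatever its colour. The
  case r = 0 later evaluates the zero kernel.\<close>

lemma hom_sum_scale:
  assumes "\<And>e. e \<in> E \<Longrightarrow> \<alpha> e \<in> {0, 1}"
  shows "hom_sum I V E \<alpha> (\<lambda>p. of_real r * G p) = of_real (r ^ card E) * hom_sum I V E \<alpha> G"
proof -
  have "(\<Prod>(u, v)\<in>E. coloured_factor (\<alpha> (u, v)) (of_real r * G (\<phi> u, \<phi> v))) =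
      (\<Prod>e\<in>E. of_real r) * (\<Prod>(u, v)\<in>E. coloured_factor (\<alpha> (u, v)) (G (\<phi> u, \<phi> v)))" for \<phi>
    unfolding prod.distrib[symmetric]
    using assms by (intro prod.cong) (auto simp: coloured_factor_mult coloured_factor_of_real)
  then show ?thesis by (simp add: hom_sum_def edge_product_def sum_distrib_left)
qed

text \<open>Phrased by cuts instead of paths: direct sums call for an edge crossing a given vertex
  set, and the negation hands over the set along which the graph splits.\<close>

definition edge_connected :: "'v set \<Rightarrow> ('v \<times> 'v) set \<Rightarrow> bool" where
  "edge_connected V E \<longleftrightarrow>
     (\<forall>W. W \<subset> V \<longrightarrow> W \<noteq> {} \<longrightarrow> (\<exists>u v. (u, v) \<in> E \<and> (u \<in> W) \<noteq> (v \<in> W)))"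

text \<open>If an assignment takes values in both blocks, the vertices sent to \<open>I\<close> form
  a proper nonempty set; an edge crossing it has kernel value 0 and kills the product. V is nonempty
  so that the empty assignment is not counted in both blocks.\<close>

lemma hom_sum_direct_sum:
  assumes V: "finite V" "V \<noteq> {}" and E: "E \<subseteq> V \<times> V" and I: "finite I" "finite J" "I \<inter> J = {}"
    and conn: "edge_connected V E"
    and \<alpha>: "\<And>e. e \<in> E \<Longrightarrow> \<alpha> e \<in> {0, 1}"
    and K: "\<And>i j. i \<in> I \<Longrightarrow> j \<in> J \<Longrightarrow> K (i, j) = 0 \<and> K (j, i) = 0"
  shows "hom_sum (I \<union> J) V E \<alpha> K = hom_sum I V E \<alpha> K + hom_sum J V E \<alpha> K"
proof -
  have finE: "finite E" using V E finite_subset by blast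
  have "hom_sum (I \<union> J) V E \<alpha> K =
      (\<Sum>\<phi>\<in>(V \<rightarrow>\<^sub>E I) \<union> (V \<rightarrow>\<^sub>E J). \<Prod>(u, v)\<in>E. coloured_factor (\<alpha> (u, v)) (K (\<phi> u, \<phi> v)))"
    unfolding hom_sum_def edge_product_def
  proof (rule sum.mono_neutral_right)
    show "finite (V \<rightarrow>\<^sub>E I \<union> J)" using V I by (intro finite_PiE) auto
    show "(V \<rightarrow>\<^sub>E I) \<union> (V \<rightarrow>\<^sub>E J) \<subseteq> V \<rightarrow>\<^sub>E I \<union> J" by (auto simp: PiE_iff)
    show "\<forall>\<phi>\<in>(V \<rightarrow>\<^sub>E I \<union> J) - ((V \<rightarrow>\<^sub>E I) \<union> (V \<rightarrow>\<^sub>E J)).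
        (\<Prod>(u, v)\<in>E. coloured_factor (\<alpha> (u, v)) (K (\<phi> u, \<phi> v))) = 0"
    proof
      fix \<phi> assume \<phi>: "\<phi> \<in> (V \<rightarrow>\<^sub>E I \<union> J) - ((V \<rightarrow>\<^sub>E I) \<union> (V \<rightarrow>\<^sub>E J))"
      define W where "W = {v \<in> V. \<phi> v \<in> I}"
      have "W \<noteq> {}" "W \<subset> V" using \<phi> by (auto simp: W_def PiE_iff)
      then obtain u v where uv: "(u, v) \<in> E" "(u \<in> W) \<noteq> (v \<in> W)"
        using conn unfolding edge_connected_def by blast
      then have "u \<in> V" "v \<in> V" using E by auto
      then have "K (\<phi> u, \<phi> v) = 0" using uv \<phi> K by (auto simp: W_def PiE_iff)
      then show "(\<Prod>(u, v)\<in>E. coloured_factor (\<alpha> (u, v)) (K (\<phi> u, \<phi> v))) = 0"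
        using uv finE coloured_factor_zero \<alpha> by (intro prod_zero bexI[of _ "(u, v)"]) auto
    qed
  qed
  also have "\<dots> = hom_sum I V E \<alpha> K + hom_sum J V E \<alpha> K"
    unfolding hom_sum_def edge_product_def
  proof (rule sum.union_disjoint)
    show "(V \<rightarrow>\<^sub>E I) \<inter> (V \<rightarrow>\<^sub>E J) = {}"
      using \<open>I \<inter> J = {}\<close> \<open>V \<noteq> {}\<close> by (auto simp: PiE_Int PiE_eq_empty_iff)
  qed (use V I in \<open>auto intro!: finite_PiE\<close>)
  finally show ?thesis .
qed

text \<open>No edge joins the two parts, so an assignment is an independent choice on each of
  them.\<close>

lemma hom_sum_disjoint_union:
  assumes V: "W \<inter> W' = {}" and finE: "finite E" "finite E'"
    and E: "E \<subseteq> W \<times> W" "E' \<subseteq> W' \<times> W'"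
  shows "hom_sum I (W \<union> W') (E \<union> E') \<alpha> G = hom_sum I W E \<alpha> G * hom_sum I W' E' \<alpha> G"
  unfolding hom_sum_def edge_product_def sum_product sum.cartesian_product
proof (rule sum.reindex_bij_witness
    [of _ "\<lambda>(\<phi>, \<psi>). merge W W' (\<phi>, \<psi>)" "\<lambda>\<rho>. (restrict \<rho> W, restrict \<rho> W')"])
  fix \<rho> assume \<rho>: "\<rho> \<in> W \<union> W' \<rightarrow>\<^sub>E I"
  show "(case (restrict \<rho> W, restrict \<rho> W') of (\<phi>, \<psi>) \<Rightarrow> merge W W' (\<phi>, \<psi>)) = \<rho>"
    using \<rho> by (auto simp: fun_eq_iff PiE_iff extensional_def merge_def)
  show "(restrict \<rho> W, restrict \<rho> W') \<in> (W \<rightarrow>\<^sub>E I) \<times> (W' \<rightarrow>\<^sub>E I)"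
    using \<rho> by (auto simp: PiE_iff)
  have disj: "E \<inter> E' = {}" using V E by blast
  have "(\<Prod>(u, v)\<in>E. coloured_factor (\<alpha> (u, v)) (G (restrict \<rho> W u, restrict \<rho> W v))) =
      (\<Prod>(u, v)\<in>E. coloured_factor (\<alpha> (u, v)) (G (\<rho> u, \<rho> v)))"
    using E by (intro prod.cong) auto
  moreover have "(\<Prod>(u, v)\<in>E'. coloured_factor (\<alpha> (u, v)) (G (restrict \<rho> W' u, restrict \<rho> W' v))) =
      (\<Prod>(u, v)\<in>E'. coloured_factor (\<alpha> (u, v)) (G (\<rho> u, \<rho> v)))"
    using E by (intro prod.cong) auto
  ultimately show "(case (restrict \<rho> W, restrict \<rho> W') of (\<phi>, \<psi>) \<Rightarrow>
      (\<Prod>(u, v)\<in>E. coloured_factor (\<alpha> (u, v)) (G (\<phi> u, \<phi> v))) *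
      (\<Prod>(u, v)\<in>E'. coloured_factor (\<alpha> (u, v)) (G (\<psi> u, \<psi> v)))) =
    (\<Prod>(u, v)\<in>E \<union> E'. coloured_factor (\<alpha> (u, v)) (G (\<rho> u, \<rho> v)))"
    using finE disj by (simp add: prod.union_disjoint)
next
  fix p assume "p \<in> (W \<rightarrow>\<^sub>E I) \<times> (W' \<rightarrow>\<^sub>E I)"
  then obtain \<phi> \<psi> where p: "p = (\<phi>, \<psi>)" "\<phi> \<in> W \<rightarrow>\<^sub>E I" "\<psi> \<in> W' \<rightarrow>\<^sub>E I" by blast
  show "(restrict (case p of (\<phi>, \<psi>) \<Rightarrow> merge W W' (\<phi>, \<psi>)) W,
      restrict (case p of (\<phi>, \<psi>) \<Rightarrow> merge W W' (\<phi>, \<psi>)) W') = p"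
    using p V by (auto simp: fun_eq_iff PiE_iff extensional_def merge_def)
  show "(case p of (\<phi>, \<psi>) \<Rightarrow> merge W W' (\<phi>, \<psi>)) \<in> W \<union> W' \<rightarrow>\<^sub>E I"
    using p by (auto simp: PiE_iff merge_def extensional_def)
qed

section \<open>Positivity of homomorphism sums at nonzero kernels\<close>

lemma hom_sum_positive_connected:
  fixes G :: "nat \<times> nat \<Rightarrow> complex"
  assumes V: "finite V" "V \<noteq> {}" and E: "E \<subseteq> V \<times> V" "E \<noteq> {}"
    and conn: "edge_connected V E"
    and \<alpha>: "\<And>e. e \<in> E \<Longrightarrow> \<alpha> e \<in> {0, 1}"
    and nonzero: "\<And>N (G :: nat \<times> nat \<Rightarrow> complex).
      \<exists>i<N. \<exists>j<N. G (i, j) \<noteq> 0 \<Longrightarrow> hom_sum {..<N} V E \<alpha> G \<noteq> 0"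
    and G: "\<exists>i<N. \<exists>j<N. G (i, j) \<noteq> 0"
  shows "hom_sum {..<N} V E \<alpha> G \<in> complex_of_real ` {0<..}"
proof -
  \<comment> \<open>All N are collected in one set, because the kernels realising sums and products
    live on larger index sets.\<close>
  define S where "S = {hom_sum {..<N} V E \<alpha> G |N (G :: nat \<times> nat \<Rightarrow> complex).
      \<exists>i<N. \<exists>j<N. G (i, j) \<noteq> 0}"
  have S_E: "\<exists>N (G :: nat \<times> nat \<Rightarrow> complex).
      x = hom_sum {..<N} V E \<alpha> G \<and> (\<exists>i<N. \<exists>j<N. G (i, j) \<noteq> 0)" if "x \<in> S" for x
    using that unfolding S_def mem_Collect_eq .
  have S_I: "hom_sum {..<N} V E \<alpha> G \<in> S" if "\<exists>i<N. \<exists>j<N. G (i, j) \<noteq> 0"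
    for N and G :: "nat \<times> nat \<Rightarrow> complex"
    using that unfolding S_def by blast
  have n: "0 < card E" using V E finite_subset[of E "V \<times> V"] by (simp add: card_gt_0_iff)
  have "S \<subseteq> complex_of_real ` {0<..}"
  proof (rule cone_semiring_positive)
    show "0 \<notin> S" using nonzero by (auto simp: S_def)
    have "V \<rightarrow>\<^sub>E {..<Suc 0} = {\<lambda>v\<in>V. 0}"
      by (auto simp: PiE_iff extensional_def fun_eq_iff)
    then have "hom_sum {..<Suc 0} V E \<alpha> (\<lambda>p. 1) = 1"
      by (simp add: hom_sum_def edge_product_def case_prod_unfold)
    then show "1 \<in> S" using S_I[of "Suc 0" "\<lambda>p. 1"] by simp
  next
    fix x y assume "x \<in> S" "y \<in> S"
    from S_E[OF \<open>x \<in> S\<close>] obtain M :: nat and G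
      where x: "x = hom_sum {..<M} V E \<alpha> G" "\<exists>i<M. \<exists>j<M. G (i, j) \<noteq> 0"
      by blast
    from S_E[OF \<open>y \<in> S\<close>] obtain N :: nat and H
      where y: "y = hom_sum {..<N} V E \<alpha> H" "\<exists>i<N. \<exists>j<N. H (i, j) \<noteq> 0"
      by blast
    \<comment> \<open>The block-diagonal sum of \<open>G\<close> and \<open>H\<close>; shifting the
      second block by \<open>M\<close> makes the index sets disjoint.\<close>
    define K where "K = (\<lambda>(i, j). if i < M \<and> j < M then G (i, j)
      else if i \<ge> M \<and> j \<ge> M then H (i - M, j - M) else 0)"
    have "hom_sum ({..<M} \<union> {M..<M + N}) V E \<alpha> K =
        hom_sum {..<M} V E \<alpha> K + hom_sum {M..<M + N} V E \<alpha> K"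
      using V E conn \<alpha> by (intro hom_sum_direct_sum) (auto simp: K_def)
    also have "hom_sum {..<M} V E \<alpha> K = x"
      unfolding x using E by (intro hom_sum_cong) (auto simp: K_def)
    also have "bij_betw (\<lambda>i. i + M) {..<N} {M..<M + N}"
      by (rule bij_betw_byWitness[where f' = "\<lambda>i. i - M"]) auto
    then have "hom_sum {M..<M + N} V E \<alpha> K = hom_sum {..<N} V E \<alpha> (\<lambda>(i, j). K (i + M, j + M))"
      by (rule hom_sum_reindex[symmetric]) (rule E)
    also have "\<dots> = y"
      unfolding y using E by (intro hom_sum_cong) (auto simp: K_def)
    also have "{..<M} \<union> {M..<M + N} = {..<M + N}" by auto
    finally have "x + y = hom_sum {..<M + N} V E \<alpha> K" by simp
    moreover have "\<exists>i<M+N. \<exists>j<M+N. K (i, j) \<noteq> 0"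
    proof -
      obtain i j where "i < M" "j < M" "G (i, j) \<noteq> 0" using x(2) by blast
      then show ?thesis by (intro exI[of _ i] exI[of _ j] conjI) (auto simp: K_def)
    qed
    ultimately show "x + y \<in> S" using S_I by metis
    \<comment> \<open>The Kronecker product is indexed by pairs; \<open>h\<close> enumerates them by
      an initial segment.\<close>
    obtain h where h: "bij_betw h {..<M * N} ({..<M} \<times> {..<N})"
      using ex_bij_betw_nat_finite[of "{..<M} \<times> {..<N}"] by (auto simp: lessThan_atLeast0)
    define L where "L = (\<lambda>((i, j), (k, l)). G (i, k) * H (j, l))"
    have "hom_sum {..<M * N} V E \<alpha> (\<lambda>(i, j). L (h i, h j)) = x * y"
      unfolding hom_sum_reindex[OF h E(1)] unfolding L_def x y by (rule hom_sum_tensor) (rule E)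
    moreover have "\<exists>i<M * N. \<exists>j<M * N. L (h i, h j) \<noteq> 0"
    proof -
      obtain i k j l where "i < M" "k < M" "j < N" "l < N" "G (i, k) \<noteq> 0" "H (j, l) \<noteq> 0"
        using x y by blast
      then have *: "(i, j) \<in> h ` {..<M * N}" "(k, l) \<in> h ` {..<M * N}" "L ((i, j), (k, l)) \<noteq> 0"
        using h by (auto simp: bij_betw_def L_def)
      then obtain m m' where "m < M * N" "m' < M * N" "h m = (i, j)" "h m' = (k, l)"
        by (metis imageE lessThan_iff)
      then show ?thesis using *(3) by metis
    qed
    ultimately show "x * y \<in> S" using S_I[of "M * N" "\<lambda>(i, j). L (h i, h j)"] by simp
  next
    fix r :: real and x assume "0 < r" "x \<in> S"
    from S_E[OF \<open>x \<in> S\<close>] obtain M :: nat and G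
      where x: "x = hom_sum {..<M} V E \<alpha> G" "\<exists>i<M. \<exists>j<M. G (i, j) \<noteq> 0"
      by blast
    \<comment> \<open>Each edge contributes one factor, so scaling the value by r takes the
      \<open>card E\<close>-th root of r on the kernel.\<close>
    define s where "s = root (card E) r"
    have s: "0 < s" "s ^ card E = r" using \<open>0 < r\<close> n by (auto simp: s_def)
    have "of_real r * x = hom_sum {..<M} V E \<alpha> (\<lambda>p. of_real s * G p)"
      using hom_sum_scale[of E \<alpha>, OF \<alpha>, of "{..<M}" V s G] s by (simp add: x)
    moreover have "\<exists>i<M. \<exists>j<M. of_real s * G (i, j) \<noteq> 0" using x s by auto
    ultimately show "of_real r * x \<in> S" using S_I[of M "\<lambda>p. of_real s * G p"] by simp
  qed
  then show ?thesis using S_I[OF G] by blast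
qed

text \<open>Induction on the vertex set along disconnections. The nonvanishing hypothesis ranges
  over all kernels, so it passes to each factor of the product; the induction then makes both
  factors positive.\<close>

lemma hom_sum_positive:
  fixes G :: "nat \<times> nat \<Rightarrow> complex"
  assumes "finite V" and "E \<subseteq> V \<times> V"
    and "\<And>e. e \<in> E \<Longrightarrow> \<alpha> e \<in> {0, 1}"
    and "\<And>N (G :: nat \<times> nat \<Rightarrow> complex).
      \<exists>i<N. \<exists>j<N. G (i, j) \<noteq> 0 \<Longrightarrow> hom_sum {..<N} V E \<alpha> G \<noteq> 0"
    and "\<exists>i<N. \<exists>j<N. G (i, j) \<noteq> 0"
  shows "hom_sum {..<N} V E \<alpha> G \<in> complex_of_real ` {0<..}"
  using assms
proof (induction V arbitrary: E rule: finite_psubset_induct)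
  case (psubset V)
  note E = psubset.prems(1) and \<alpha> = psubset.prems(2) and nonzero = psubset.prems(3)
    and G = psubset.prems(4)
  consider "E = {}" | "E \<noteq> {}" "edge_connected V E" | "\<not> edge_connected V E" by blast
  then show ?case
  proof cases
    case 1
    \<comment> \<open>Every assignment contributes 1, and the nonzero entry of \<open>G\<close>
      forces N > 0.\<close>
    have "hom_sum {..<N} V E \<alpha> G = of_real (real N ^ card V)"
      using psubset.hyps by (simp add: 1 hom_sum_def edge_product_def card_PiE)
    then show ?thesis using G by (auto intro!: image_eqI[of _ _ "real N ^ card V"])
  next
    case 2
    moreover have "V \<noteq> {}" using 2 E by auto
    ultimately show ?thesis using psubset.hyps E \<alpha> nonzero G by (intro hom_sum_positive_connected)
  next
    case 3
    then obtain W where W: "W \<subset> V" "W \<noteq> {}" "\<And>u v. (u, v) \<in> E \<Longrightarrow> u \<in> W \<longleftrightarrow> v \<in> W"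
      unfolding edge_connected_def by blast
    define W' E1 E2 where "W' = V - W" and "E1 = E \<inter> W \<times> W" and "E2 = E \<inter> W' \<times> W'"
    have V_eq: "W \<union> W' = V" and E_eq: "E1 \<union> E2 = E"
      using W E by (auto simp: W'_def E1_def E2_def)
    have finE: "finite E" using psubset.hyps E finite_subset by blast
    have prod: "hom_sum {..<N} V E \<alpha> G = hom_sum {..<N} W E1 \<alpha> G * hom_sum {..<N} W' E2 \<alpha> G"
      for N and G :: "nat \<times> nat \<Rightarrow> complex"
      unfolding V_eq[symmetric] E_eq[symmetric]
      by (rule hom_sum_disjoint_union) (use finE in \<open>auto simp: W'_def E1_def E2_def\<close>)
    have "hom_sum {..<N} W E1 \<alpha> G \<in> complex_of_real ` {0<..}"
    proof (rule psubset.IH)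
      show "hom_sum {..<N} W E1 \<alpha> G \<noteq> 0" if "\<exists>i<N. \<exists>j<N. G (i, j) \<noteq> 0"
        for N and G :: "nat \<times> nat \<Rightarrow> complex"
        using nonzero[OF that] by (simp add: prod)
    qed (use W \<alpha> G in \<open>auto simp: E1_def\<close>)
    moreover have "hom_sum {..<N} W' E2 \<alpha> G \<in> complex_of_real ` {0<..}"
    proof (rule psubset.IH)
      show "hom_sum {..<N} W' E2 \<alpha> G \<noteq> 0" if "\<exists>i<N. \<exists>j<N. G (i, j) \<noteq> 0"
        for N and G :: "nat \<times> nat \<Rightarrow> complex"
        using nonzero[OF that] by (simp add: prod)
    qed (use W \<alpha> G in \<open>auto simp: E2_def W'_def\<close>)
    ultimately show ?thesis unfolding prod
      by (auto intro!: image_eqI simp flip: of_real_mult)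
  qed
qed

section \<open>The uniform measure on the cube\<close>

abbreviation unit_interval :: "real measure" where
  "unit_interval \<equiv> restrict_space lborel {0..1}"

abbreviation unit_cube :: "'v set \<Rightarrow> ('v \<Rightarrow> real) measure" where
  "unit_cube V \<equiv> Pi\<^sub>M V (\<lambda>_. unit_interval)"

lemma prob_space_unit_interval: "prob_space unit_interval"
  by (rule prob_space_restrict_space) auto

lemma prob_space_unit_cube: "prob_space (unit_cube V)"
  by (intro prob_space_PiM prob_space_unit_interval)

lemma coordinate_measurable_borel: "u \<in> V \<Longrightarrow> (\<lambda>z. z u) \<in> borel_measurable (unit_cube V)"
  by (rule measurable_compose[OF measurable_component_singleton[of u V]])
     (auto intro: measurable_restrict_space1)

text \<open>Two distinct coordinates are independent and uniform. Rectangles determine the product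
  measure, and a rectangle pulls back to a cylinder.\<close>

lemma distr_unit_cube_pair:
  assumes "u \<in> V" "v \<in> V" "u \<noteq> v"
  shows "unit_interval \<Otimes>\<^sub>M unit_interval =
    distr (unit_cube V) (unit_interval \<Otimes>\<^sub>M unit_interval) (\<lambda>z. (z u, z v))"
proof (rule pair_measure_eqI)
  interpret U: prob_space unit_interval by (rule prob_space_unit_interval)
  show "sigma_finite_measure unit_interval" by unfold_locales
  then show "sigma_finite_measure unit_interval" .
  fix A B assume AB: "A \<in> sets unit_interval" "B \<in> sets unit_interval"
  define X where "X = (\<lambda>w. if w = u then A else B)"
  have "(\<lambda>z. (z u, z v)) -` (A \<times> B) \<inter> space (unit_cube V) =
      prod_emb V (\<lambda>_. unit_interval) {u, v} (Pi\<^sub>E {u, v} X)"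
    using assms by (auto simp: prod_emb_def space_PiM X_def PiE_iff)
  moreover have "emeasure (unit_cube V) \<dots> = (\<Prod>w\<in>{u, v}. emeasure unit_interval (X w))"
    using assms AB by (intro emeasure_PiM_emb prob_space_unit_interval) (auto simp: X_def)
  ultimately show "emeasure unit_interval A * emeasure unit_interval B =
      emeasure (distr (unit_cube V) (unit_interval \<Otimes>\<^sub>M unit_interval) (\<lambda>z. (z u, z v))) (A \<times> B)"
    using assms AB by (subst emeasure_distr) (auto simp: X_def)
qed simp

text \<open>Used for the exceptional set on which f differs from a Borel function. The vertices must
  be distinct: for u = v the null diagonal would be a counterexample.\<close>

lemma AE_unit_cube_pair:
  assumes uv: "u \<in> V" "v \<in> V" "u \<noteq> v" and N: "N \<in> null_sets (lborel :: (real \<times> real) measure)"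
  shows "AE z in unit_cube V. (z u, z v) \<notin> N"
proof -
  interpret U: prob_space unit_interval by (rule prob_space_unit_interval)
  interpret UU: pair_prob_space unit_interval unit_interval ..
  have meas: "N \<inter> unit_square \<in> sets (unit_interval \<Otimes>\<^sub>M unit_interval)"
  proof -
    have "(\<lambda>p. p) \<in> unit_interval \<Otimes>\<^sub>M unit_interval \<rightarrow>\<^sub>M borel \<Otimes>\<^sub>M borel"
      by (intro measurable_pair) (auto simp: comp_def intro!: measurable_compose[OF measurable_fst]
          measurable_compose[OF measurable_snd] measurable_restrict_space1)
    from measurable_sets[OF this, of N] have "N \<inter> unit_square \<in> sets (unit_interval \<Otimes>\<^sub>M unit_interval)"
      if "N \<in> sets (borel \<Otimes>\<^sub>M borel)"
      using that by (simp add: space_pair_measure)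
    then show ?thesis using N unfolding borel_prod by auto
  qed
  have "AE p in lborel \<Otimes>\<^sub>M lborel. p \<notin> N"
    unfolding lborel_prod using N by (rule AE_not_in)
  \<comment> \<open>The passage to the unit interval is made one variable at a time, between Fubini
    and its converse.\<close>
  then have "AE x in lborel. AE y in lborel. (x, y) \<notin> N"
    by (rule lborel_pair.AE_pair)
  then have "AE x in unit_interval. AE y in unit_interval. (x, y) \<notin> N"
    by (auto simp: AE_restrict_space_iff elim!: eventually_mono)
  then have "AE p in unit_interval \<Otimes>\<^sub>M unit_interval. p \<notin> N"
  proof (rule UU.AE_pair_measure[rotated])
    have "{p \<in> space (unit_interval \<Otimes>\<^sub>M unit_interval). p \<notin> N} =
        space (unit_interval \<Otimes>\<^sub>M unit_interval) - N \<inter> unit_square"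
      by (auto simp: space_pair_measure)
    then show "{p \<in> space (unit_interval \<Otimes>\<^sub>M unit_interval). p \<notin> N}
        \<in> sets (unit_interval \<Otimes>\<^sub>M unit_interval)"
      using meas by auto
  qed
  then have "AE p in distr (unit_cube V) (unit_interval \<Otimes>\<^sub>M unit_interval) (\<lambda>z. (z u, z v)). p \<notin> N"
    unfolding distr_unit_cube_pair[OF uv, symmetric] .
  then show ?thesis by (rule AE_distrD[rotated]) (use uv in measurable)
qed

text \<open>A Borel function can be composed with coordinates in the uncompleted product measure,
  and a bound valid at every point makes all its edge products integrable.\<close>

lemma bounded_measurable_borel_version:
  assumes f: "f \<in> bounded_measurable_on_square"
  obtains g C N where "g \<in> borel_measurable borel" "\<And>p. cmod (g p) \<le> C"
    "N \<in> null_sets lborel" "\<And>p. p \<in> unit_square - N \<Longrightarrow> f p = g p"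
proof -
  have sq: "unit_square \<in> sets lebesgue" 
    by (rule sets_completionI_sets) (auto intro!: borel_closed closed_Times)
  have meas: "f \<in> borel_measurable (lebesgue_on unit_square)"
    and bdd: "bounded (f ` unit_square)"
    using f by (auto simp: bounded_measurable_on_square_def)
  obtain C where C: "0 \<le> C" "\<And>p. p \<in> unit_square \<Longrightarrow> cmod (f p) \<le> C"
  proof -
    obtain b where "\<forall>x\<in>f ` unit_square. cmod x \<le> b" using bdd by (auto simp: bounded_iff)
    then show ?thesis by (intro that[of "max 0 b"]) (auto simp: le_max_iff_disj)
  qed
  \<comment> \<open>Off the square f is unconstrained; extension by 0 yields a function measurable
    on the whole plane.\<close>
  define h where "h = (\<lambda>p. if p \<in> unit_square then f p else 0)"
  have h: "h \<in> borel_measurable lebesgue"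
    unfolding h_def using borel_measurable_if[OF sq] meas by blast
  then have "(\<lambda>p. Re (h p)) \<in> borel_measurable lebesgue" "(\<lambda>p. Im (h p)) \<in> borel_measurable lebesgue"
    by simp_all
  from this[THEN completion_ex_borel_measurable_real] obtain a b
    where a: "a \<in> borel_measurable lborel" "AE p in lborel. Re (h p) = a p"
      and b: "b \<in> borel_measurable lborel" "AE p in lborel. Im (h p) = b p"
    by blast
  \<comment> \<open>Off the null set below, the value has modulus at most \<open>C\<close> and is
    kept; the cut-off secures the bound on the null set as well.\<close>
  define g where "g = (\<lambda>p. if cmod (Complex (a p) (b p)) \<le> C then Complex (a p) (b p) else 0)"
  have "AE p in lborel. h p = Complex (a p) (b p)"
    using a(2) b(2) by eventually_elim (simp add: complex_eq_iff)
  then obtain N where N: "N \<in> null_sets lborel" "\<And>p. p \<notin> N \<Longrightarrow> h p = Complex (a p) (b p)"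
    by (auto elim!: AE_E3)
  show ?thesis
  proof
    have "(\<lambda>p. Complex (a p) (b p)) = (\<lambda>p. of_real (a p) + \<i> * of_real (b p))"
      by (simp add: complex_eq_iff fun_eq_iff)
    then have [measurable]: "(\<lambda>p. Complex (a p) (b p)) \<in> borel_measurable borel"
      using a(1) b(1) by simp
    show "g \<in> borel_measurable borel" unfolding g_def by measurable
    show "cmod (g p) \<le> C" for p using C(1) by (simp add: g_def)
    show "N \<in> null_sets lborel" by fact
    show "f p = g p" if "p \<in> unit_square - N" for p
    proof -
      have "f p = Complex (a p) (b p)" using N(2)[of p] that by (simp add: h_def split: if_splits)
      then show ?thesis using C(2)[of p] that by (simp add: g_def)
    qed
  qed
qed

section \<open>Measurability and integrability of edge products\<close>

lemma coloured_factor_measurable [measurable]: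
  "f \<in> borel_measurable M \<Longrightarrow> (\<lambda>x. coloured_factor c (f x)) \<in> borel_measurable M"
  unfolding coloured_factor_def
  by (intro borel_measurable_times borel_measurable_power)
     (auto intro: borel_measurable_continuous_on[of cnj] continuous_intros)

lemma measurable_kernel_pair:
  assumes "g \<in> borel_measurable borel" "u \<in> V" "v \<in> V"
  shows "(\<lambda>z. g (z u, z v)) \<in> borel_measurable (unit_cube V)"
  using assms coordinate_measurable_borel
  by (intro measurable_compose[of "\<lambda>z. (z u, z v)" _ borel g])
     (auto simp: borel_prod[symmetric] intro!: measurable_Pair)

text \<open>The map \<open>\<phi>\<close> covers both uses: the identity gives the integrand on the
  cube over V, and a map into \<open>{..<N}\<close> gives a kernel evaluated at sample
  points.\<close>

lemma edge_product_measurable: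
  assumes "g \<in> borel_measurable borel" "E \<subseteq> V \<times> V" "\<phi> \<in> V \<rightarrow> I"
  shows "(\<lambda>z. edge_product E \<alpha> g (\<lambda>v. z (\<phi> v))) \<in> borel_measurable (unit_cube I)"
  unfolding edge_product_def case_prod_unfold
  by (intro borel_measurable_prod coloured_factor_measurable measurable_kernel_pair)
     (use assms in auto)

lemma norm_edge_product_le:
  assumes "\<And>e. e \<in> E \<Longrightarrow> \<alpha> e \<in> {0, 1}" "\<And>p. cmod (g p) \<le> C"
  shows "cmod (edge_product E \<alpha> g z) \<le> C ^ card E"
proof -
  have "cmod (edge_product E \<alpha> g z) = (\<Prod>e\<in>E. cmod (g (z (fst e), z (snd e))))"
    unfolding edge_product_def prod_norm[symmetric]
    using assms by (intro prod.cong) (auto simp: norm_coloured_factor case_prod_unfold)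
  also have "\<dots> \<le> (\<Prod>e\<in>E. C)" using assms by (intro prod_mono) auto
  finally show ?thesis by simp
qed

lemma edge_product_integrable:
  assumes "g \<in> borel_measurable borel" "E \<subseteq> V \<times> V" "\<phi> \<in> V \<rightarrow> I"
    and "\<And>e. e \<in> E \<Longrightarrow> \<alpha> e \<in> {0, 1}" "\<And>p. cmod (g p) \<le> C"
  shows "integrable (unit_cube I) (\<lambda>z. edge_product E \<alpha> g (\<lambda>v. z (\<phi> v)))"
proof -
  interpret prob_space "unit_cube I" by (rule prob_space_unit_cube)
  show ?thesis
  proof (rule integrable_const_bound[of _ "C ^ card E"])
    show "AE z in unit_cube I. cmod (edge_product E \<alpha> g (\<lambda>v. z (\<phi> v))) \<le> C ^ card E"
      by (intro AE_I2 norm_edge_product_le assms)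
  qed (rule edge_product_measurable[OF assms(1-3)])
qed

text \<open>Moves the density from the completed cube to the plain product measure, where
  independence and product integrals are available. Edge ends are distinct because the parts are
  disjoint, so almost every assignment avoids \<open>N\<close> at all edges.\<close>

lemma hom_density_borel:
  assumes V: "finite (A \<union> B)" and E: "E \<subseteq> A \<times> B" and disj: "A \<inter> B = {}"
    and g: "g \<in> borel_measurable borel" and N: "N \<in> null_sets lborel"
    and fg: "\<And>p. p \<in> unit_square - N \<Longrightarrow> f p = g p"
  shows "hom_density A B E \<alpha> f = (LINT z|unit_cube (A \<union> B). edge_product E \<alpha> g z)"
proof -
  define V where "V = A \<union> B"
  have finE: "finite E" using V E by (meson finite_Un finite_SigmaI finite_subset)
  have EV: "E \<subseteq> V \<times> V" using E by (auto simp: V_def)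
  have gm: "edge_product E \<alpha> g \<in> borel_measurable (unit_cube V)"
    using edge_product_measurable[OF g EV, of "\<lambda>v. v" V] by simp
  have "AE z in unit_cube V. \<forall>e\<in>E. (z (fst e), z (snd e)) \<notin> N"
  proof (rule AE_finite_allI[OF finE])
    fix e assume "e \<in> E"
    then have "fst e \<in> A" "snd e \<in> B" using E by auto
    then show "AE z in unit_cube V. (z (fst e), z (snd e)) \<notin> N"
      using disj by (intro AE_unit_cube_pair N) (auto simp: V_def)
  qed
  then have ae: "AE z in unit_cube V. edge_product E \<alpha> f z = edge_product E \<alpha> g z"
    using AE_space
  proof eventually_elim
    case (elim z)
    have "f (z u, z v) = g (z u, z v)" if "(u, v) \<in> E" for u v
    proof (rule fg)
      have "u \<in> V" "v \<in> V" using that EV by auto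
      then have "z u \<in> {0..1}" "z v \<in> {0..1}" using elim(2) by (auto simp: space_PiM PiE_iff)
      then show "(z u, z v) \<in> unit_square - N" using elim(1) that by force
    qed
    then show ?case unfolding edge_product_def by (intro prod.cong) auto
  qed
  \<comment> \<open>Measurability for f comes from completeness: its edge product agrees almost
    everywhere with that of \<open>g\<close>.\<close>
  have fm: "edge_product E \<alpha> f \<in> borel_measurable (completion (unit_cube V))"
  proof (rule measurableI)
    fix S :: "complex set" assume S: "S \<in> sets borel"
    show "edge_product E \<alpha> f -` S \<inter> space (completion (unit_cube V)) \<in> sets (completion (unit_cube V))"
    proof (rule completion.in_sets_AE)
      show "AE z in completion (unit_cube V).
          z \<in> edge_product E \<alpha> g -` S \<inter> space (completion (unit_cube V)) \<longleftrightarrow>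
          z \<in> edge_product E \<alpha> f -` S \<inter> space (completion (unit_cube V))"
        using AE_completion[OF ae] by eventually_elim auto
      show "edge_product E \<alpha> g -` S \<inter> space (completion (unit_cube V)) \<in> sets (completion (unit_cube V))"
        using measurable_sets[OF measurable_completion[OF gm] S] .
    qed auto
  qed simp
  have "hom_density A B E \<alpha> f = (LINT z|completion (unit_cube V). edge_product E \<alpha> f z)"
    by (simp add: hom_density_def vertex_cube_def edge_product_def coloured_factor_def V_def)
  also have "\<dots> = (LINT z|completion (unit_cube V). edge_product E \<alpha> g z)"
    using AE_completion[OF ae] by (intro integral_cong_AE fm measurable_completion gm)
  also have "\<dots> = (LINT z|unit_cube V. edge_product E \<alpha> g z)"
    by (rule integral_completion[OF gm])
  finally show ?thesis by (simp add: V_def)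
qed

section \<open>Step kernels\<close>

text \<open>Half-open cells of side 1/N with the same partition on both axes, so that one index per
  vertex names a cell of the vertex cube.\<close>

definition step_kernel :: "nat \<Rightarrow> (nat \<times> nat \<Rightarrow> complex) \<Rightarrow> real \<times> real \<Rightarrow> complex" where
  "step_kernel N G p = G (nat \<lfloor>real N * fst p\<rfloor>, nat \<lfloor>real N * snd p\<rfloor>)"

lemma step_kernel_measurable: "step_kernel N G \<in> borel_measurable borel"
proof -
  have "(\<lambda>p. (nat \<lfloor>real N * fst p\<rfloor>, nat \<lfloor>real N * snd p\<rfloor>))
      \<in> (borel :: (real \<times> real) measure) \<rightarrow>\<^sub>M count_space UNIV \<Otimes>\<^sub>M count_space UNIV"
    unfolding borel_prod[symmetric] by measurable
  then have "(\<lambda>p. (nat \<lfloor>real N * fst p\<rfloor>, nat \<lfloor>real N * snd p\<rfloor>))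
      \<in> (borel :: (real \<times> real) measure) \<rightarrow>\<^sub>M count_space UNIV"
    by (simp add: pair_measure_countable)
  then show ?thesis unfolding step_kernel_def by (rule measurable_compose) simp
qed

lemma floor_index_le: "x \<in> {0..1} \<Longrightarrow> nat \<lfloor>real N * x\<rfloor> \<le> N"
  using mult_left_mono[of x 1 "real N"] by (simp add: floor_le_iff nat_le_iff le_less_trans)

lemma floor_index_less: "0 < N \<Longrightarrow> x \<in> {0..<1} \<Longrightarrow> nat \<lfloor>real N * x\<rfloor> < N"
  by (simp add: nat_less_iff floor_less_iff)

lemma step_kernel_bounded_measurable: "step_kernel N G \<in> bounded_measurable_on_square"
proof -
  have "step_kernel N G ` unit_square \<subseteq> G ` ({..N} \<times> {..N})"
    using floor_index_le by (fastforce simp: step_kernel_def)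
  then have "bounded (step_kernel N G ` unit_square)"
    by (rule bounded_subset[rotated]) (auto intro: finite_imp_bounded)
  moreover have "step_kernel N G \<in> borel_measurable (lebesgue_on unit_square)"
    using step_kernel_measurable by (intro measurable_restrict_space1 measurable_completion) simp
  ultimately show ?thesis by (simp add: bounded_measurable_on_square_def)
qed

text \<open>On the interior of cell (i, j) the step function is constantly \<open>G (i, j)\<close>,
  and a nonempty open set is not negligible.\<close>

lemma not_zero_ae_step_kernel:
  assumes ij: "i < N" "j < N" and G: "G (i, j) \<noteq> 0"
  shows "\<not> zero_ae (step_kernel N G)"
proof
  define S where "S = {real i / N<..<real (Suc i) / N} \<times> {real j / N<..<real (Suc j) / N}"
  assume "zero_ae (step_kernel N G)"
  moreover have "unit_square \<in> sets lebesgue"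
    by (rule sets_completionI_sets) (auto intro!: borel_closed closed_Times)
  ultimately have "AE p in lebesgue. p \<in> unit_square \<longrightarrow> step_kernel N G p = 0"
    by (simp add: zero_ae_def AE_restrict_space_iff)
  moreover have idx: "x \<in> {0..1} \<and> nat \<lfloor>real N * x\<rfloor> = k"
    if "k < N" "real k / N < x" "x < real (Suc k) / N" for k x
  proof -
    have 1: "real k < real N * x" "real N * x < real k + 1"
      using that by (simp_all add: field_simps)
    moreover have "0 \<le> x" using that
      by (meson divide_nonneg_nonneg less_imp_le of_nat_0_le_iff order_trans)
    moreover have "x \<le> 1"
    proof -
      have "real (Suc k) / N \<le> 1" using that by (simp add: field_simps)
      then show ?thesis using that by linarith
    qed
    moreover have "\<lfloor>real N * x\<rfloor> = int k" using 1 by (simp add: floor_eq_iff)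
    ultimately show ?thesis by simp
  qed
  then have "p \<in> unit_square \<and> step_kernel N G p \<noteq> 0" if "p \<in> S" for p
    using that ij G by (auto simp: S_def step_kernel_def)
  ultimately have "AE p in lebesgue. p \<notin> S"
    by (auto elim!: eventually_mono)
  then have "negligible S"
    by (simp add: negligible_iff_null_sets completion.null_sets_iff_AE)
  moreover have "open S" unfolding S_def by (intro open_Times open_greaterThanLessThan)
  moreover have "S \<noteq> {}" using ij by (auto simp: S_def divide_le_cancel)
  ultimately show False using open_not_negligible by blast
qed

lemma integral_floor_index:
  assumes "i < N"
  shows "(LINT x|unit_interval. of_bool (nat \<lfloor>real N * x\<rfloor> = i)) = (1 / real N :: real)"
proof -
  have "{x \<in> {0..1}. nat \<lfloor>real N * x\<rfloor> = i} = {real i / N..<real (Suc i) / N}"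
  proof (intro set_eqI iffI)
    fix x assume x: "x \<in> {x \<in> {0..1}. nat \<lfloor>real N * x\<rfloor> = i}"
    then have "\<lfloor>real N * x\<rfloor> = int i" by auto
    then have "real i \<le> real N * x" "real N * x < real i + 1" by (simp_all add: floor_eq_iff)
    then show "x \<in> {real i / N..<real (Suc i) / N}" using assms by (simp add: field_simps)
  next
    fix x assume x: "x \<in> {real i / N..<real (Suc i) / N}"
    then have "real i \<le> real N * x" "real N * x < real i + 1" using assms by (simp_all add: field_simps)
    then have "\<lfloor>real N * x\<rfloor> = int i" by (simp add: floor_eq_iff)
    moreover have "0 \<le> x" using x by (auto intro: order_trans[of 0 "real i / N"])
    moreover have "real (Suc i) / N \<le> 1" using assms by (simp add: field_simps)
    then have "x \<le> 1" using x by auto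
    ultimately show "x \<in> {x \<in> {0..1}. nat \<lfloor>real N * x\<rfloor> = i}" by simp
  qed
  then have eq: "indicator {0..1} x *\<^sub>R of_bool (nat \<lfloor>real N * x\<rfloor> = i) =
      (indicator {real i / N..<real (Suc i) / N} x :: real)" for x
    by (auto simp: indicator_def set_eq_iff)
  have "(LINT x|unit_interval. of_bool (nat \<lfloor>real N * x\<rfloor> = i)) =
      (LINT x|lborel. indicator {real i / N..<real (Suc i) / N} x :: real)"
    by (subst integral_restrict_space) (simp_all only: eq, simp_all)
  also have "\<dots> = 1 / N" using assms by (simp add: divide_right_mono flip: diff_divide_distrib)
  finally show ?thesis .
qed

text \<open>Almost every point of the cube lies in exactly one product cell, named by an assignment
  into \<open>{..<N}\<close>. The integrand is constant on it, and by independence its volume is the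
  product of the side lengths 1/N.\<close>

lemma hom_density_step_kernel:
  assumes V: "finite (A \<union> B)" and E: "E \<subseteq> A \<times> B" and disj: "A \<inter> B = {}" and N: "0 < N"
  shows "hom_density A B E \<alpha> (step_kernel N G) =
    hom_sum {..<N} (A \<union> B) E \<alpha> G / of_nat (N ^ card (A \<union> B))"
proof -
  define V where "V = A \<union> B"
  have finV: "finite V" and EV: "E \<subseteq> V \<times> V" using V E by (auto simp: V_def)
  interpret U: prob_space unit_interval by (rule prob_space_unit_interval)
  interpret P: product_sigma_finite "\<lambda>_ :: 'a. unit_interval" ..
  \<comment> \<open>The coordinate 1 would have the out-of-range index \<open>N\<close>.\<close>
  have one: "AE z in unit_cube V. \<forall>v\<in>V. z v \<noteq> 1"
  proof (rule AE_finite_allI[OF finV])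
    fix v assume "v \<in> V"
    moreover have "AE x in unit_interval. x \<noteq> 1"
      by (auto simp: AE_restrict_space_iff intro: eventually_mono[OF AE_lborel_singleton[of 1]])
    ultimately show "AE z in unit_cube V. z v \<noteq> 1"
      using prob_space_unit_interval by (intro AE_PiM_component[where P = "\<lambda>x. x \<noteq> 1"])
  qed
  \<comment> \<open>The product of these factors over V is the indicator of the cell named by
    \<open>\<phi>\<close>.\<close>
  define ind :: "('a \<Rightarrow> nat) \<Rightarrow> 'a \<Rightarrow> real \<Rightarrow> complex"
    where "ind = (\<lambda>\<phi> v x. of_bool (nat \<lfloor>real N * x\<rfloor> = \<phi> v))"
  have ind_meas: "ind \<phi> v \<in> borel_measurable unit_interval" for \<phi> v
    unfolding ind_def by (intro measurable_restrict_space1) measurable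
  have ind_int: "integrable unit_interval (ind \<phi> v)" for \<phi> v
    by (rule U.integrable_const_bound[of _ 1]) (auto simp: ind_meas, simp add: ind_def)
  have ind_val: "integral\<^sup>L unit_interval (ind \<phi> v) = 1 / of_nat N" if "\<phi> v < N" for \<phi> v
  proof -
    have "ind \<phi> v = (\<lambda>x. of_real (of_bool (nat \<lfloor>real N * x\<rfloor> = \<phi> v)))"
      by (simp add: ind_def fun_eq_iff)
    then show ?thesis by (simp only: integral_complex_of_real integral_floor_index[OF that]) simp
  qed
  have "hom_density A B E \<alpha> (step_kernel N G) =
      (LINT z|unit_cube V. edge_product E \<alpha> (step_kernel N G) z)"
    unfolding V_def
    by (rule hom_density_borel[OF V E disj step_kernel_measurable, of "{}"]) auto
  also have "\<dots> = (LINT z|unit_cube V.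
      (\<Sum>\<phi>\<in>V \<rightarrow>\<^sub>E {..<N}. (\<Prod>v\<in>V. ind \<phi> v (z v)) * edge_product E \<alpha> G \<phi>))"
  proof (rule integral_cong_AE)
    show "edge_product E \<alpha> (step_kernel N G) \<in> borel_measurable (unit_cube V)"
      using edge_product_measurable[OF step_kernel_measurable EV, of "\<lambda>v. v" V] by simp
    have "(\<lambda>z. ind \<phi> v (z v)) \<in> borel_measurable (unit_cube V)" if "v \<in> V" for \<phi> v
      by (rule measurable_compose[OF measurable_component_singleton[OF that] ind_meas])
    then show "(\<lambda>z. \<Sum>\<phi>\<in>V \<rightarrow>\<^sub>E {..<N}. (\<Prod>v\<in>V. ind \<phi> v (z v)) * edge_product E \<alpha> G \<phi>)
        \<in> borel_measurable (unit_cube V)"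
      by (intro borel_measurable_sum borel_measurable_times borel_measurable_prod borel_measurable_const)
    show "AE z in unit_cube V. edge_product E \<alpha> (step_kernel N G) z =
        (\<Sum>\<phi>\<in>V \<rightarrow>\<^sub>E {..<N}. (\<Prod>v\<in>V. ind \<phi> v (z v)) * edge_product E \<alpha> G \<phi>)"
      using one AE_space
    proof eventually_elim
      case (elim z)
      \<comment> \<open>This names the cell of z. Any other assignment differs from it at some
        vertex, where its indicator factor is 0.\<close>
      define \<psi> where "\<psi> = (\<lambda>v\<in>V. nat \<lfloor>real N * z v\<rfloor>)"
      have \<psi>: "\<psi> \<in> V \<rightarrow>\<^sub>E {..<N}"
      proof -
        have "z v \<in> {0..<1}" if "v \<in> V" for v
          using that elim by (force simp: space_PiM PiE_iff less_le)
        then show ?thesis using floor_index_less[OF N] by (auto simp: \<psi>_def)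
      qed
      have "(\<Sum>\<phi>\<in>V \<rightarrow>\<^sub>E {..<N}. (\<Prod>v\<in>V. ind \<phi> v (z v)) * edge_product E \<alpha> G \<phi>) =
          sum (\<lambda>\<phi>. (\<Prod>v\<in>V. ind \<phi> v (z v)) * edge_product E \<alpha> G \<phi>) {\<psi>}"
      proof (rule sum.mono_neutral_right)
        show "\<forall>\<phi>\<in>(V \<rightarrow>\<^sub>E {..<N}) - {\<psi>}. (\<Prod>v\<in>V. ind \<phi> v (z v)) * edge_product E \<alpha> G \<phi> = 0"
        proof
          fix \<phi> assume \<phi>: "\<phi> \<in> (V \<rightarrow>\<^sub>E {..<N}) - {\<psi>}"
          then obtain v where "v \<in> V" "\<phi> v \<noteq> \<psi> v"
            using \<psi> PiE_ext[of \<phi> V _ \<psi>] by blast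
          then have "ind \<phi> v (z v) = 0" by (simp add: ind_def \<psi>_def)
          then show "(\<Prod>v\<in>V. ind \<phi> v (z v)) * edge_product E \<alpha> G \<phi> = 0"
            using \<open>v \<in> V\<close> finV by (auto intro!: prod_zero)
        qed
      qed (use \<psi> finV in \<open>auto intro!: finite_PiE\<close>)
      also have "\<dots> = edge_product E \<alpha> G \<psi>" by (simp add: ind_def \<psi>_def)
      also have "\<dots> = edge_product E \<alpha> (step_kernel N G) z"
        unfolding edge_product_def using EV
        by (intro prod.cong) (auto simp: step_kernel_def \<psi>_def)
      finally show ?case ..
    qed
  qed
  also have "\<dots> = (\<Sum>\<phi>\<in>V \<rightarrow>\<^sub>E {..<N}. LINT z|unit_cube V. (\<Prod>v\<in>V. ind \<phi> v (z v)) * edge_product E \<alpha> G \<phi>)"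
    by (intro Bochner_Integration.integral_sum integrable_mult_left P.product_integrable_prod finV ind_int)
  also have "\<dots> = (\<Sum>\<phi>\<in>V \<rightarrow>\<^sub>E {..<N}. edge_product E \<alpha> G \<phi> / of_nat (N ^ card V))"
  proof (rule sum.cong[OF refl])
    fix \<phi> assume \<phi>: "\<phi> \<in> V \<rightarrow>\<^sub>E {..<N}"
    have "(LINT z|unit_cube V. (\<Prod>v\<in>V. ind \<phi> v (z v)) * edge_product E \<alpha> G \<phi>) =
        (\<Prod>v\<in>V. integral\<^sup>L unit_interval (ind \<phi> v)) * edge_product E \<alpha> G \<phi>"
      by (simp add: P.product_integral_prod[OF finV ind_int])
    also have "(\<Prod>v\<in>V. integral\<^sup>L unit_interval (ind \<phi> v)) = (\<Prod>v\<in>V. 1 / of_nat N)"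
      using \<phi> by (intro prod.cong refl ind_val) auto
    finally show "(LINT z|unit_cube V. (\<Prod>v\<in>V. ind \<phi> v (z v)) * edge_product E \<alpha> G \<phi>) =
        edge_product E \<alpha> G \<phi> / of_nat (N ^ card V)"
      by (simp add: power_one_over)
  qed
  also have "\<dots> = hom_sum {..<N} V E \<alpha> G / of_nat (N ^ card V)"
    by (simp add: hom_sum_def sum_divide_distrib)
  finally show ?thesis by (simp add: V_def)
qed

section \<open>Sampling\<close>

text \<open>A union bound over pairs of distinct vertices: an assignment that identifies u and v is
  determined by its values off v.\<close>

lemma card_noninjective_le:
  assumes V: "finite V"
  shows "card {\<phi> \<in> V \<rightarrow>\<^sub>E {..<N}. \<not> inj_on \<phi> V} \<le> card V ^ 2 * N ^ (card V - 1)"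
proof -
  define D where "D = {p \<in> V \<times> V. fst p \<noteq> snd p}"
  define Q where "Q = (\<lambda>p. {\<phi> \<in> V \<rightarrow>\<^sub>E {..<N}. \<phi> (fst p) = \<phi> (snd p)})"
  have finD: "finite D" using V by (simp add: D_def)
  have finQ: "finite (Q p)" for p using V by (auto simp: Q_def intro!: finite_PiE)
  have "card {\<phi> \<in> V \<rightarrow>\<^sub>E {..<N}. \<not> inj_on \<phi> V} \<le> card (\<Union>p\<in>D. Q p)"
    using finD finQ by (intro card_mono) (auto simp: D_def Q_def inj_on_def)
  also have "\<dots> \<le> (\<Sum>p\<in>D. card (Q p))" by (rule card_UN_le[OF finD])
  also have "\<dots> \<le> (\<Sum>p\<in>D. N ^ (card V - 1))"
  proof (rule sum_mono)
    fix p assume "p \<in> D"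
    then obtain u v where p: "p = (u, v)" "u \<in> V" "v \<in> V" "u \<noteq> v" by (auto simp: D_def)
    have "inj_on (\<lambda>\<phi>. restrict \<phi> (V - {v})) (Q p)"
    proof (rule inj_onI)
      fix \<phi> \<psi> assume \<phi>: "\<phi> \<in> Q p" and \<psi>: "\<psi> \<in> Q p"
        and eq: "restrict \<phi> (V - {v}) = restrict \<psi> (V - {v})"
      have off: "\<phi> w = \<psi> w" if "w \<in> V" "w \<noteq> v" for w
        using fun_cong[OF eq, of w] that by simp
      then have "\<phi> v = \<psi> v" using \<phi> \<psi> p by (simp add: Q_def)
      then show "\<phi> = \<psi>" using \<phi> \<psi> off by (intro PiE_ext[of \<phi> V "\<lambda>_. {..<N}" \<psi>]) (auto simp: Q_def)
    qed
    moreover have "(\<lambda>\<phi>. restrict \<phi> (V - {v})) ` Q p \<subseteq> V - {v} \<rightarrow>\<^sub>E {..<N}"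
      by (force simp: Q_def PiE_iff)
    ultimately have "card (Q p) \<le> card (V - {v} \<rightarrow>\<^sub>E {..<N})"
      using V by (intro card_inj_on_le) (auto intro!: finite_PiE)
    then show "card (Q p) \<le> N ^ (card V - 1)" using V p by (simp add: card_PiE)
  qed
  also have "\<dots> = card D * N ^ (card V - 1)" by simp
  also have "card D \<le> card V ^ 2"
    using card_mono[of "V \<times> V" D] V by (auto simp: D_def card_cartesian_product power2_eq_square)
  finally show ?thesis by simp
qed

text \<open>Distinct sample points are independent and uniform, so along an injective
  \<open>\<phi>\<close> they have the law of the cube over V.\<close>

lemma integral_edge_product_inj:
  assumes g: "g \<in> borel_measurable borel" and E: "E \<subseteq> V \<times> V"
    and \<phi>: "inj_on \<phi> V" "\<phi> \<in> V \<rightarrow> I"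
  shows "(LINT z|unit_cube I. edge_product E \<alpha> g (\<lambda>v. z (\<phi> v))) = (LINT z|unit_cube V. edge_product E \<alpha> g z)"
proof -
  have "(LINT z|unit_cube V. edge_product E \<alpha> g z) =
      (LINT z|distr (unit_cube I) (unit_cube V) (\<lambda>z. \<lambda>v\<in>V. z (\<phi> v)). edge_product E \<alpha> g z)"
    using distr_PiM_reindex[OF prob_space_unit_interval \<phi>] by simp
  also have "\<dots> = (LINT z|unit_cube I. edge_product E \<alpha> g (\<lambda>v\<in>V. z (\<phi> v)))"
  proof (rule integral_distr)
    show "(\<lambda>z. \<lambda>v\<in>V. z (\<phi> v)) \<in> unit_cube I \<rightarrow>\<^sub>M unit_cube V"
      using \<phi> by (intro measurable_restrict measurable_component_singleton) auto
    show "edge_product E \<alpha> g \<in> borel_measurable (unit_cube V)"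
      using edge_product_measurable[OF g E, of "\<lambda>v. v" V] by simp
  qed
  also have "\<dots> = (LINT z|unit_cube I. edge_product E \<alpha> g (\<lambda>v. z (\<phi> v)))"
    unfolding edge_product_def using E by (intro Bochner_Integration.integral_cong prod.cong) auto
  finally show ?thesis ..
qed

text \<open>At each sample z the sum over all assignments is the homomorphism sum of a finite
  kernel, hence nonnegative, and so is its expectation. Convergence of expectations suffices; no
  concentration is involved.\<close>

lemma integral_edge_product_nonneg:
  assumes V: "finite V" "V \<noteq> {}" and E: "E \<subseteq> V \<times> V"
    and g: "g \<in> borel_measurable borel" and C: "\<And>p. cmod (g p) \<le> C"
    and \<alpha>: "\<And>e. e \<in> E \<Longrightarrow> \<alpha> e \<in> {0, 1}"
    and nonneg: "\<And>N (G :: nat \<times> nat \<Rightarrow> complex). hom_sum {..<N} V E \<alpha> G \<in> \<real>\<^sub>\<ge>\<^sub>0"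
  shows "(LINT z|unit_cube V. edge_product E \<alpha> g z) \<in> \<real>\<^sub>\<ge>\<^sub>0"
proof -
  define T where "T = (LINT z|unit_cube V. edge_product E \<alpha> g z)"
  define I where "I = (\<lambda>(N :: nat) \<phi>. LINT z|unit_cube {..<N}. edge_product E \<alpha> g (\<lambda>v. z (\<phi> v)))"
  define k where "k = card V"
  define K where "K = C ^ card E"
  define mean where "mean = (\<lambda>N. (\<Sum>\<phi>\<in>V \<rightarrow>\<^sub>E {..<N}. I N \<phi>) / of_nat (N ^ k))"
  have k: "0 < k" using V by (simp add: k_def card_gt_0_iff)
  \<comment> \<open>Stated over an arbitrary index set, since it is applied to the N sample points
    and, with the identity map, to V itself.\<close>
  have bound: "cmod (LINT z|unit_cube J. edge_product E \<alpha> g (\<lambda>v. z (\<phi> v))) \<le> K"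
    if "\<phi> \<in> V \<rightarrow> J" for J :: "'b set" and \<phi> :: "'a \<Rightarrow> 'b"
  proof -
    interpret prob_space "unit_cube J" by (rule prob_space_unit_cube)
    have int: "integrable (unit_cube J) (\<lambda>z. edge_product E \<alpha> g (\<lambda>v. z (\<phi> v)))"
      by (rule edge_product_integrable[OF g E that \<alpha> C])
    have "cmod (LINT z|unit_cube J. edge_product E \<alpha> g (\<lambda>v. z (\<phi> v))) \<le>
        (LINT z|unit_cube J. cmod (edge_product E \<alpha> g (\<lambda>v. z (\<phi> v))))"
      by (rule integral_norm_bound)
    also have "\<dots> \<le> (LINT z|unit_cube J. K)"
      unfolding K_def
      by (intro integral_mono integrable_norm int norm_edge_product_le[OF \<alpha> C]) auto
    finally show ?thesis by (simp add: prob_space)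
  qed
  have fin: "finite (V \<rightarrow>\<^sub>E {..<N})" for N :: nat using V by (intro finite_PiE) auto
  have mean_nonneg: "mean N \<in> \<real>\<^sub>\<ge>\<^sub>0" for N
  proof -
    let ?h = "\<lambda>z. hom_sum {..<N} V E \<alpha> (\<lambda>(i, j). g (z i, z j))"
    have "(\<Sum>\<phi>\<in>V \<rightarrow>\<^sub>E {..<N}. I N \<phi>) =
        (LINT z|unit_cube {..<N}.
          (\<Sum>\<phi>\<in>V \<rightarrow>\<^sub>E {..<N}. edge_product E \<alpha> g (\<lambda>v. z (\<phi> v))))"
      unfolding I_def
      by (intro Bochner_Integration.integral_sum[symmetric] edge_product_integrable[OF g E _ \<alpha> C]) auto
    also have "\<dots> = (LINT z|unit_cube {..<N}. of_real (Re (?h z)))"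
    proof (rule Bochner_Integration.integral_cong[OF refl])
      fix z
      have "?h z = of_real (Re (?h z))"
        using nonneg[of N "\<lambda>(i, j). g (z i, z j)"]
        by (simp add: complex_nonneg_Reals_iff complex_eq_iff)
      then show "(\<Sum>\<phi>\<in>V \<rightarrow>\<^sub>E {..<N}. edge_product E \<alpha> g (\<lambda>v. z (\<phi> v))) = of_real (Re (?h z))"
        by (simp add: hom_sum_def edge_product_def)
    qed
    also have "\<dots> = of_real (LINT z|unit_cube {..<N}. Re (?h z))"
      by (rule integral_complex_of_real)
    also have "\<dots> \<in> \<real>\<^sub>\<ge>\<^sub>0"
      using nonneg[of N] by (auto simp: complex_nonneg_Reals_iff intro!: integral_nonneg_AE)
    finally show ?thesis unfolding mean_def by (intro nonneg_Reals_divide_I) auto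
  qed
  \<comment> \<open>Of the \<open>N ^ k\<close> assignments, at most
    \<open>k ^ 2 * N ^ (k - 1)\<close> are not injective, and each of these deviates from
    \<open>T\<close> by at most \<open>2 * K\<close>.\<close>
  have close: "norm (mean N - T) \<le> 2 * K * k ^ 2 / N" if N: "0 < N" for N
  proof -
    let ?B = "{\<phi> \<in> V \<rightarrow>\<^sub>E {..<N}. \<not> inj_on \<phi> V}"
    have card: "card (V \<rightarrow>\<^sub>E {..<N}) = N ^ k" using V by (simp add: card_PiE k_def)
    have "mean N - T = (\<Sum>\<phi>\<in>V \<rightarrow>\<^sub>E {..<N}. I N \<phi> - T) / of_nat (N ^ k)"
      using N card by (simp add: mean_def sum_subtractf field_simps)
    also have "(\<Sum>\<phi>\<in>V \<rightarrow>\<^sub>E {..<N}. I N \<phi> - T) = (\<Sum>\<phi>\<in>?B. I N \<phi> - T)"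
    proof (rule sum.mono_neutral_right[OF fin])
      show "\<forall>\<phi>\<in>(V \<rightarrow>\<^sub>E {..<N}) - ?B. I N \<phi> - T = 0"
        using integral_edge_product_inj[OF g E] by (auto simp: I_def T_def)
    qed auto
    finally have "norm (mean N - T) = norm (\<Sum>\<phi>\<in>?B. I N \<phi> - T) / N ^ k"
      by (simp add: norm_divide norm_power)
    also have "norm (\<Sum>\<phi>\<in>?B. I N \<phi> - T) \<le> (\<Sum>\<phi>\<in>?B. 2 * K)"
    proof (rule sum_norm_le)
      fix \<phi> assume \<phi>: "\<phi> \<in> ?B"
      have "cmod (I N \<phi>) \<le> K" unfolding I_def using \<phi> by (intro bound) auto
      moreover have "cmod T \<le> K" unfolding T_def using bound[of "\<lambda>v. v" V] by simp
      ultimately show "cmod (I N \<phi> - T) \<le> 2 * K" using norm_triangle_ineq4[of "I N \<phi>" T] by simp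
    qed
    also have "\<dots> = 2 * K * card ?B" by simp
    also have "\<dots> \<le> 2 * K * (k ^ 2 * N ^ (k - 1))"
    proof (rule mult_left_mono)
      show "real (card ?B) \<le> k ^ 2 * N ^ (k - 1)"
        using card_noninjective_le[OF V(1), of N] by (simp only: k_def of_nat_le_iff flip: of_nat_mult of_nat_power)
      have "0 \<le> C" by (rule order_trans[OF norm_ge_zero C])
      then show "0 \<le> 2 * K" by (simp add: K_def)
    qed
    \<comment> \<open>Since k > 0, the exponent k - 1 is a true predecessor and one factor 1/N
      remains.\<close>
    also have "2 * K * (k ^ 2 * N ^ (k - 1)) / N ^ k = 2 * K * k ^ 2 / N"
      using N k by (cases k) (simp_all add: field_simps)
    finally show ?thesis using N by (simp add: divide_right_mono)
  qed
  have "mean \<longlonglongrightarrow> T"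
  proof (rule Lim_null_comparison[THEN LIM_zero_cancel])
    show "\<forall>\<^sub>F N in sequentially. norm (mean N - T) \<le> 2 * K * k ^ 2 / N"
      using eventually_gt_at_top[of 0] by eventually_elim (rule close)
    show "(\<lambda>N. 2 * K * k ^ 2 / real N) \<longlonglongrightarrow> 0" by (rule lim_const_over_n)
  qed
  then have "T \<in> \<real>\<^sub>\<ge>\<^sub>0"
    using closed_sequentially[OF closed_nonneg_Reals_complex] mean_nonneg by blast
  then show ?thesis unfolding T_def .
qed

section \<open>From the norming property to positivity of the density\<close>

theorem theorem4p12:
  fixes A B :: "'v set" and E :: "('v \<times> 'v) set" and \<alpha> :: "'v \<times> 'v \<Rightarrow> nat"
    and f :: "real \<times> real \<Rightarrow> complex"
  assumes "finite_bipartite_graph A B E"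
    and "\<alpha> \<in> E \<rightarrow> {0, 1}"
    and "complex_norming A B E \<alpha>"
    and "f \<in> bounded_measurable_on_square"
    and "\<not> zero_ae f"
  shows "hom_density A B E \<alpha> f \<in> \<real> \<and> 0 < Re (hom_density A B E \<alpha> f)"
proof -
  interpret finite_bipartite_graph A B E by fact
  define V where "V = A \<union> B"
  have V: "finite V" "V \<noteq> {}" and EV: "E \<subseteq> V \<times> V"
    using finite_A finite_B vertices_nonempty edges by (auto simp: V_def)
  have E: "E \<noteq> {}" using V no_isolated_A no_isolated_B by (fastforce simp: V_def)
  have finE: "finite E" using V EV finite_subset by blast
  have \<alpha>: "\<And>e. e \<in> E \<Longrightarrow> \<alpha> e \<in> {0, 1}" using assms(2) by auto
  \<comment> \<open>A zero density would make its root zero as well, since \<open>0 powr\<close> any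
    exponent is 0, and the norming property then forces the function to vanish almost
    everywhere.\<close>
  have nonzero: "hom_density A B E \<alpha> f \<noteq> 0"
    if "f \<in> bounded_measurable_on_square" "\<not> zero_ae f" for f
    using assms(3) that by (auto simp: complex_norming_def Let_def)
  have pos: "hom_sum {..<N} V E \<alpha> G \<in> complex_of_real ` {0<..}"
    if "\<exists>i<N. \<exists>j<N. G (i, j) \<noteq> 0" for N and G :: "nat \<times> nat \<Rightarrow> complex"
  proof (rule hom_sum_positive[OF V(1) EV \<alpha> _ that])
    fix N and G :: "nat \<times> nat \<Rightarrow> complex"
    assume G: "\<exists>i<N. \<exists>j<N. G (i, j) \<noteq> 0"
    then have "hom_density A B E \<alpha> (step_kernel N G) \<noteq> 0"
      using not_zero_ae_step_kernel by (intro nonzero step_kernel_bounded_measurable) blast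
    moreover have "0 < N" using G by auto
    then have "hom_density A B E \<alpha> (step_kernel N G) = hom_sum {..<N} V E \<alpha> G / of_nat (N ^ card V)"
      using V edges disjoint_parts unfolding V_def by (intro hom_density_step_kernel)
    ultimately show "hom_sum {..<N} V E \<alpha> G \<noteq> 0" by auto
  qed
  \<comment> \<open>The zero kernel has to be included, because f may vanish at all sampled pairs;
    as E is nonempty, scaling by 0 shows that its sum is 0.\<close>
  have nonneg: "hom_sum {..<N} V E \<alpha> G \<in> \<real>\<^sub>\<ge>\<^sub>0" for N and G :: "nat \<times> nat \<Rightarrow> complex"
  proof (cases "\<exists>i<N. \<exists>j<N. G (i, j) \<noteq> 0")
    case True
    then show ?thesis using pos[OF True] by (auto simp: complex_nonneg_Reals_iff)
  next
    case False
    then have "hom_sum {..<N} V E \<alpha> G = hom_sum {..<N} V E \<alpha> (\<lambda>p. of_real 0 * G p)"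
      using EV by (intro hom_sum_cong) auto
    also have "\<dots> = 0"
      using E finE by (subst hom_sum_scale[OF \<alpha>]) (auto simp: card_gt_0_iff)
    finally show ?thesis by simp
  qed
  obtain g C N where g: "g \<in> borel_measurable borel" "\<And>p. cmod (g p) \<le> C"
    "N \<in> null_sets lborel" "\<And>p. p \<in> unit_square - N \<Longrightarrow> f p = g p"
    using bounded_measurable_borel_version[OF assms(4)] by blast
  have "hom_density A B E \<alpha> f = (LINT z|unit_cube V. edge_product E \<alpha> g z)"
    unfolding V_def
    by (rule hom_density_borel[OF V(1)[unfolded V_def] edges disjoint_parts g(1,3,4)])
  also have "\<dots> \<in> \<real>\<^sub>\<ge>\<^sub>0"
    by (rule integral_edge_product_nonneg[OF V EV g(1,2) \<alpha> nonneg])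
  finally show ?thesis
    using nonzero[OF assms(4,5)]
    by (auto simp: complex_nonneg_Reals_iff complex_is_Real_iff complex_eq_iff less_le)
qed

end
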